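(* Let $u$ be a positive integer, let $i\ge 1$ be an integer, and let $k$ be an odd integer with $3\le k\le 2i-1$. Let $\mathfrak q$ be the largest integer not exceeding $P_{2i+1}(u)/P_k(u)$ with $\mathfrak q\equiv 1\pmod u$, and let $\mathfrak r=\bigl(P_{2i+1}(u)-\mathfrak q P_k(u)\bigr)/u$. Let $p$ be an integer with $0\le p\le(\mathfrak q-1)/u$. If $u\,\mathfrak r\,P_{2i}(u)>\bigl(P_{k-2}(u)-(u^2+1)\mathfrak r\bigr)P_{2i+1}(u)$, then $$g_p\bigl(P_{2i+1}(u),P_{2i+3}(u),P_{2i+k+1}(u)\bigr)=(\mathfrak r-1)P_{2i+3}(u)+\bigl(\mathfrak q+(p+1)u-1\bigr)P_{2i+k+1}(u)-P_{2i+1}(u).$$ Otherwise, $$g_p\bigl(P_{2i+1}(u),P_{2i+3}(u),P_{2i+k+1}(u)\bigr)=\bigl(P_k(u)-1\bigr)P_{2i+3}(u)+(\mathfrak q+pu-1)P_{2i+k+1}(u)-P_{2i+1}(u).$$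
   Context: For a fixed positive integer $u$, the Pell-type numbers $P_n(u)$ are defined by $P_0(u)=0$, $P_1(u)=1$ and $P_n(u)=uP_{n-1}(u)+P_{n-2}(u)$ for $n\ge 2$. Let $A=\{a_1,\dots,a_\kappa\}$ be a set of positive integers with $\gcd(a_1,\dots,a_\kappa)=1$ and let $p$ be a nonnegative integer. $S_p(A)$ is the set of integers $n$ for which there are more than $p$ tuples $(x_1,\dots,x_\kappa)$ of nonnegative integers with $n=x_1a_1+\cdots+x_\kappa a_\kappa$. The set $\mathbb{N}_0\setminus S_p(A)$, with $\mathbb{N}_0=\{0,1,2,\dots\}$, is finite; the $p$-Frobenius number $g_p(A)=g_p(a_1,\dots,a_\kappa)$ is its largest element. *)

theory Defs
  imports Complex_Main "HOL-Library.FuncSet" "HOL-Number_Theory.Cong"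
begin

fun pell :: "int \<Rightarrow> nat \<Rightarrow> int" where
  "pell u 0 = 0"
| "pell u (Suc 0) = 1"
| "pell u (Suc (Suc n)) = u * pell u (Suc n) + pell u n"

(* A tuple of coefficients is a function on the generating set A, made extensional so
   that functions differing only outside A are not counted twice. *)
definition representations :: "int set \<Rightarrow> int \<Rightarrow> (int \<Rightarrow> nat) set" where
  "representations A n = {x \<in> A \<rightarrow>\<^sub>E UNIV. n = (\<Sum>a\<in>A. int (x a) * a)}"

(* Intended for finite sets A of positive integers; then each n has only finitely many
   representations, so card is their actual number. *)
definition S_p :: "nat \<Rightarrow> int set \<Rightarrow> int set" where
  "S_p p A = {n. card (representations A n) > p}"

(* Meaningful when {0..} - S_p p A is finite and nonempty.  For a finite set A of positive
   integers with gcd 1 it is finite, and it is nonempty unless p = 0 and 1 \<in> A. *)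
definition frobenius :: "nat \<Rightarrow> int set \<Rightarrow> int" where
  "frobenius p A = Max ({0..} - S_p p A)"

end

theory Submission
  imports Defs
begin

text \<open>
  Write \<open>a, b, c\<close> for the three generators and \<open>P\<close> for \<open>P\<^sub>k\<close>. The pairs \<open>(y, z)\<close> with
  \<open>a dvd y * b + z * c\<close> form a lattice of index \<open>a\<close> with basis \<open>v = (r, q)\<close> and \<open>w = (P, - u)\<close>,
  and \<open>w\<close> has the small positive weight \<open>P * b - u * c = a * P\<^sub>k\<^sub>-\<^sub>2\<close>. A residue class modulo \<open>a\<close> meets
  the quadrant in finite chains parallel to \<open>w\<close>. As \<open>p * u < q\<close>, the first two of these chains
  already provide \<open>p + 1\<close> light points. The extreme case is a class whose first chain has exactly \<open>p\<close>
  points, so that the lightest point of the second chain counts; the heaviest such points are the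
  corners \<open>(P - 1, q + p * u - 1)\<close> and \<open>(r - 1, q + (p + 1) * u - 1)\<close>.
\<close>

section \<open>Representations as pairs of coefficients\<close>

text \<open>The coefficient of \<open>a\<close> is determined by those of \<open>b\<close> and
  \<open>c\<close>; it exists exactly when the remainder is a nonnegative multiple of
  \<open>a\<close>. The strict order serves to keep the generators distinct.\<close>

lemma card_representations_eq:
  fixes a b c n :: int
  assumes "0 < a" "a < b" "b < c"
  shows "card (representations {a, b, c} n) =
    card {(y, z). 0 \<le> y \<and> 0 \<le> z \<and> y * b + z * c \<le> n \<and> a dvd n - (y * b + z * c)}"
    (is "_ = card ?S")
proof -
  have ne: "a \<noteq> b" "a \<noteq> c" "b \<noteq> c" using assms by auto
  let ?f = "\<lambda>x :: int \<Rightarrow> nat. (int (x b), int (x c))"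
  have rep: "n = int (x a) * a + (int (x b) * b + int (x c) * c)"
    if "x \<in> representations {a, b, c} n" for x
    using that ne by (simp add: representations_def)
  have "bij_betw ?f (representations {a, b, c} n) ?S"
  proof (rule bij_betwI')
    fix x y assume x: "x \<in> representations {a, b, c} n" and y: "y \<in> representations {a, b, c} n"
    show "(?f x = ?f y) = (x = y)"
    proof
      assume eq: "?f x = ?f y"
      then have "int (x a) * a = int (y a) * a" using rep[OF x] rep[OF y] by auto
      then have "x a = y a" using assms(1) by (metis mult_cancel_right of_nat_eq_iff less_irrefl)
      then show "x = y" using eq x y
        by (intro PiE_ext[of x "{a, b, c}" "\<lambda>_. UNIV" y]) (auto simp: representations_def)
    qed simp
  next
    fix x assume x: "x \<in> representations {a, b, c} n"
    have "0 \<le> int (x a) * a" using assms by simp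
    moreover have "n - (int (x b) * b + int (x c) * c) = a * int (x a)"
      using rep[OF x] by (simp add: algebra_simps)
    ultimately show "?f x \<in> ?S" using rep[OF x] by auto
  next
    fix s assume "s \<in> ?S"
    then obtain y z where s: "s = (y, z)" "0 \<le> y" "0 \<le> z" "y * b + z * c \<le> n"
      and "a dvd n - (y * b + z * c)" by auto
    then obtain e where e: "n - (y * b + z * c) = a * e" by (auto elim: dvdE)
    then have "0 \<le> e" using s assms by (metis diff_ge_0_iff_ge zero_le_mult_iff not_less)
    let ?x = "restrict ((\<lambda>_. nat e)(b := nat y, c := nat z)) {a, b, c}"
    have "?x \<in> representations {a, b, c} n"
      using e s \<open>0 \<le> e\<close> ne by (simp add: representations_def algebra_simps)
    moreover have "s = ?f ?x" using s ne by simp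
    ultimately show "\<exists>x\<in>representations {a, b, c} n. s = ?f x" by blast
  qed
  then show ?thesis by (rule bij_betw_same_card)
qed

lemma frobenius_eqI:
  assumes "0 \<le> g" and "card (representations A g) \<le> p"
    and "\<And>n. g < n \<Longrightarrow> p < card (representations A n)"
  shows "frobenius p A = g"
  unfolding frobenius_def
proof (rule Max_eqI)
  have sub: "{0..} - S_p p A \<subseteq> {0..g}"
    using assms(3) by (auto simp: S_p_def not_less[symmetric])
  show "finite ({0..} - S_p p A)" by (rule finite_subset[OF sub]) simp
  show "y \<le> g" if "y \<in> {0..} - S_p p A" for y using that sub by auto
  show "g \<in> {0..} - S_p p A" using assms by (simp add: S_p_def)
qed

section \<open>The lattice of three abstract generators\<close>

text \<open>By \<open>a_eq\<close>, \<open>a\<close> is the absolute determinant of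
  \<open>v = (r, q)\<close> and \<open>w = (P, - u)\<close>. By \<open>b_eq\<close> and
  \<open>c_eq\<close>, the generators \<open>b\<close> and \<open>c\<close> are congruent to
  \<open>u\<close> and \<open>P\<close> modulo \<open>a\<close>, up to the common unit
  \<open>t\<close>.\<close>

locale three_generators =
  fixes a b c t u P q r d \<beta> \<gamma> :: int
  assumes u_pos: "0 < u" and r_nonneg: "0 \<le> r" and r_less: "r < P" and u_less_q: "u < q"
    and a_eq: "a = q * P + u * r"
    and b_eq: "b = u * t + \<beta> * a" and c_eq: "c = P * t + \<gamma> * a"
    and cop_u: "coprime u P" and cop_t: "coprime t a"
    and d_eq: "P * b - u * c = d * a" and d_pos: "0 < d" and d_le: "d * a \<le> c"
    and a_less_b: "a < b" and b_less_c: "b < c"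
begin

definition points :: "int \<Rightarrow> (int \<times> int) set" where
  "points n = {(y, z). 0 \<le> y \<and> 0 \<le> z \<and> y * b + z * c \<le> n \<and> a dvd n - (y * b + z * c)}"

lemma P_pos: "0 < P" using r_nonneg r_less by simp

lemma a_pos: "0 < a"
proof -
  have "0 < q * P" using P_pos u_pos u_less_q by simp
  moreover have "0 \<le> u * r" using u_pos r_nonneg by simp
  ultimately show ?thesis using a_eq by simp
qed

lemma c_pos: "0 < c" using a_pos a_less_b b_less_c by simp

lemma card_representations: "card (representations {a, b, c} n) = card (points n)"
  unfolding points_def by (rule card_representations_eq[OF a_pos a_less_b b_less_c])

lemma finite_points: "finite (points n)"
proof (rule finite_subset)
  show "points n \<subseteq> {0..n} \<times> {0..n}"
  proof
    fix s assume "s \<in> points n"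
    then obtain y z where s: "s = (y, z)" "0 \<le> y" "0 \<le> z" "y * b + z * c \<le> n"
      by (auto simp: points_def)
    have "y * 1 \<le> y * b" "z * 1 \<le> z * c"
      using s a_pos a_less_b b_less_c by (intro mult_left_mono; linarith)+
    then show "s \<in> {0..n} \<times> {0..n}" using s by auto
  qed
qed simp

text \<open>Since \<open>t\<close> is invertible modulo \<open>a\<close>, the residue class of a
  weight is governed by the linear form \<open>u * y + P * z\<close>.\<close>

lemma weight_eq: "y * b + z * c = t * (u * y + P * z) + a * (\<beta> * y + \<gamma> * z)"
  unfolding b_eq c_eq by (simp add: algebra_simps)

lemma weight_v: "r * b + q * c = a * (t + \<beta> * r + \<gamma> * q)"
proof -
  have "u * r + P * q = a" using a_eq by (simp add: algebra_simps)
  then show ?thesis using weight_eq[of r q] by (simp add: algebra_simps)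
qed

lemma weight_add_w: "(y + j * P) * b + (z - j * u) * c = y * b + z * c + j * (d * a)"
  unfolding d_eq[symmetric] by (simp add: algebra_simps)

text \<open>Lets every climb along \<open>w\<close> be paid for in copies of \<open>c\<close>, the
  unit in which the corners are expressed.\<close>

lemma j_weight_w_le: "0 \<le> j \<Longrightarrow> j * (d * a) \<le> j * u * c"
proof -
  assume j: "0 \<le> j"
  have "1 * c \<le> u * c" using u_pos c_pos by (intro mult_right_mono) auto
  then have "d * a \<le> u * c" using d_le by simp
  then have "j * (d * a) \<le> j * (u * c)" using j by (rule mult_left_mono)
  then show ?thesis by (simp add: algebra_simps)
qed

text \<open>On the lattice the form \<open>u * y + P * z\<close> equals some \<open>a * m\<close>.
  Subtracting \<open>m\<close> copies of \<open>v\<close> leaves a zero of the form, which is a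
  multiple of \<open>w\<close> because \<open>u\<close> and \<open>P\<close> are coprime.\<close>

lemma lattice_decomposition:
  assumes "a dvd y * b + z * c"
  obtains m n where "y = m * r + n * P" "z = m * q - n * u"
proof -
  have "a dvd t * (u * y + P * z)"
    using assms unfolding weight_eq by (simp add: dvd_add_left_iff)
  then have "a dvd u * y + P * z"
    using cop_t by (simp add: coprime_dvd_mult_right_iff coprime_commute)
  then obtain m where m: "u * y + P * z = a * m" by (auto elim: dvdE)
  have eq: "u * (y - m * r) = P * (m * q - z)"
    using m unfolding a_eq by (simp add: algebra_simps)
  then have "u dvd P * (m * q - z)" by (metis dvd_triv_left)
  then have "u dvd m * q - z" using cop_u by (simp add: coprime_dvd_mult_right_iff)
  then obtain n where n: "m * q - z = u * n" by (auto elim: dvdE)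
  then have "u * (y - m * r) = u * (n * P)" using eq by (simp add: algebra_simps)
  then have "y - m * r = n * P" using u_pos by simp
  then show thesis using that[of m n] n by (simp add: algebra_simps)
qed

text \<open>The L-shape consists of a \<open>P\<close> by \<open>q\<close> rectangle and an
  \<open>r\<close> by \<open>u\<close> block on top, \<open>a\<close> cells in all. A class is
  turned into a value \<open>h\<close> of the form with \<open>0 \<le> h < a\<close>, and
  \<open>u * y + P * z = h\<close> is solved with \<open>0 \<le> y < P\<close>; a negative
  \<open>z\<close> is repaired by adding \<open>v\<close> or \<open>v - w\<close>.\<close>

lemma residue_in_L_shape:
  obtains y z where "0 \<le> y" "y < P" "0 \<le> z" "z < q \<or> y < r \<and> z < q + u"
    "a dvd n - (y * b + z * c)"
proof -
  obtain t' where t': "[t * t' = 1] (mod a)" using cop_t cong_solve_coprime_int by blast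
  define h where "h = (t' * n) mod a"
  have h: "0 \<le> h" "h < a" using a_pos by (auto simp: h_def)
  have "[t * h = t * (t' * n)] (mod a)" unfolding h_def by (simp add: cong_def mod_mult_right_eq)
  moreover have "[t * (t' * n) = n] (mod a)"
    using cong_mult[OF t' cong_refl[of n]] by (simp add: mult.assoc)
  ultimately have "[t * h = n] (mod a)" by (rule cong_trans)
  then have nh: "a dvd n - t * h" unfolding cong_iff_dvd_diff by (subst dvd_diff_commute)
  have in_class: "a dvd n - (y * b + z * c)" if "a dvd h - (u * y + P * z)" for y z
  proof -
    have eq: "n - (y * b + z * c) =
        (n - t * h) + t * (h - (u * y + P * z)) - a * (\<beta> * y + \<gamma> * z)"
      unfolding weight_eq by (simp add: algebra_simps)
    show ?thesis unfolding eq by (intro dvd_diff dvd_add nh dvd_mult that dvd_triv_left)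
  qed
  obtain u' where u': "[u * u' = 1] (mod P)" using cop_u cong_solve_coprime_int by blast
  define y where "y = (u' * h) mod P"
  have y: "0 \<le> y" "y < P" using P_pos by (auto simp: y_def)
  have "[u * y = u * (u' * h)] (mod P)" unfolding y_def by (simp add: cong_def mod_mult_right_eq)
  moreover have "[u * (u' * h) = h] (mod P)"
    using cong_mult[OF u' cong_refl[of h]] by (simp add: mult.assoc)
  ultimately have "[u * y = h] (mod P)" by (rule cong_trans)
  then have "P dvd h - u * y" unfolding cong_iff_dvd_diff by (subst dvd_diff_commute)
  then obtain z where z: "h - u * y = P * z" by (auto elim: dvdE)
  have uy: "u * y < u * P" using y u_pos by simp
  \<comment> \<open>Thus \<open>z\<close> is above \<open>- u\<close>, and since
    \<open>u < q\<close>, one addition of \<open>v\<close> already makes it nonnegative.\<close>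
  have "P * (- u) < P * z" using z h uy by (simp add: algebra_simps)
  then have z_lower: "- u < z" using P_pos by (metis mult_less_cancel_left_pos)
  have hz: "u * y + P * z = h" using z by simp
  show thesis
  proof (cases "0 \<le> z")
    case True
    have "z < q \<or> y < r \<and> z < q + u"
    proof (cases "z < q")
      case False
      have "P * z < q * P + u * r - u * y" using z h a_eq by simp
      moreover have "P * q \<le> P * z" using False P_pos by simp
      ultimately have "u * y < u * r" by (simp add: algebra_simps)
      then have "y < r" using u_pos by simp
      have "u * r < u * P" "0 \<le> u * y" using r_less u_pos y by auto
      then have "P * z < P * (q + u)"
        using \<open>P * z < q * P + u * r - u * y\<close> by (simp add: algebra_simps)
      then have "z < q + u" using P_pos by simp
      with \<open>y < r\<close> show ?thesis by simp
    qed simp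
    then show thesis using that[of y z] True y in_class hz by simp
  next
    case False
    show thesis
    proof (cases "y + r < P")
      case True
      have "h - (u * (y + r) + P * (z + q)) = - a"
        using hz a_eq by (simp add: algebra_simps)
      then show thesis
        using that[of "y + r" "z + q"] True False y r_nonneg z_lower u_less_q in_class by simp
    next
      case F: False
      have "h - (u * (y + r - P) + P * (z + q + u)) = - a"
        using hz a_eq by (simp add: algebra_simps)
      then show thesis
        using that[of "y + r - P" "z + q + u"] F False y r_less z_lower u_less_q in_class by simp
    qed
  qed
qed

section \<open>More than \<open>p\<close> representations beyond the corners\<close>

text \<open>Exhibits \<open>p + 1\<close> distinct points of weight at most \<open>M\<close> in the
  class of \<open>n\<close>, drawn from the first two chains parallel to \<open>w\<close>.\<close>

lemma card_points_gt:
  assumes pu: "int p * u < q"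
    and A: "(P - 1) * b + (q + int p * u - 1) * c \<le> M"
    and B: "(r - 1) * b + (q + (int p + 1) * u - 1) * c \<le> M"
    and n: "M - a < n"
  shows "p < card (points n)"
proof -
  obtain y z where y: "0 \<le> y" "y < P" and z: "0 \<le> z" "z < q \<or> y < r \<and> z < q + u"
    and dvd0: "a dvd n - (y * b + z * c)"
    by (rule residue_in_L_shape)
  have b_pos: "0 < b" using a_pos a_less_b by simp
  have mono: "y * b + z * c \<le> y' * b + z' * c" if "y \<le> y'" "z \<le> z'" for y z y' z'
    using that b_pos c_pos by (intro add_mono mult_right_mono) auto
  \<comment> \<open>The start of the second chain: add \<open>v\<close>, and subtract
    \<open>w\<close> if this would leave the strip \<open>y < P\<close>.\<close>
  obtain y1 z1 where y1: "0 \<le> y1" "y1 < P" and z1: "z + q \<le> z1"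
    and corner1: "z1 = z + q \<or> y1 < r \<and> z1 = z + q + u"
    and val1: "u * y1 + P * z1 = u * y + P * z + a"
    and dvd1: "a dvd n - (y1 * b + z1 * c)"
  proof (cases "y + r < P")
    case True
    have "n - ((y + r) * b + (z + q) * c) = n - (y * b + z * c) - (r * b + q * c)"
      by (simp add: algebra_simps)
    then have "a dvd n - ((y + r) * b + (z + q) * c)"
      unfolding weight_v using dvd_diff[OF dvd0 dvd_triv_left] by metis
    moreover have "u * (y + r) + P * (z + q) = u * y + P * z + a"
      unfolding a_eq by (simp add: algebra_simps)
    ultimately show thesis using that[of "y + r" "z + q"] True y r_nonneg by simp
  next
    case False
    have "n - ((y + r - P) * b + (z + q + u) * c) =
        n - (y * b + z * c) - (r * b + q * c) + (P * b - u * c)"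
      by (simp add: algebra_simps)
    then have "a dvd n - ((y + r - P) * b + (z + q + u) * c)"
      unfolding weight_v d_eq
      using dvd_add[OF dvd_diff[OF dvd0 dvd_triv_left] dvd_triv_right] by metis
    moreover have "u * (y + r - P) + P * (z + q + u) = u * y + P * z + a"
      unfolding a_eq by (simp add: algebra_simps)
    ultimately show thesis
      using that[of "y + r - P" "z + q + u"] False y r_less u_pos by simp
  qed
  \<comment> \<open>An index \<open>j\<close> too large for the first chain is sent
    \<open>p - j\<close> steps up the second. Counting backwards makes few steps go with large
    \<open>j\<close>, so the bounds below cancel.\<close>
  define f where "f j = (if j * u \<le> z then (y + j * P, z - j * u)
      else (y1 + (int p - j) * P, z1 - (int p - j) * u))" for j
  have in_points: "(y', z') \<in> points n"
    if dv: "a dvd n - (y' * b + z' * c)" and "0 \<le> y'" "0 \<le> z'" "y' * b + z' * c \<le> M"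
    for y' z'
  proof -
    obtain e where e: "n - (y' * b + z' * c) = a * e" using dv by (auto elim: dvdE)
    \<comment> \<open>As \<open>n\<close> exceeds \<open>M - a\<close>, the difference is a multiple
      of \<open>a\<close> above \<open>- a\<close>, hence nonnegative.\<close>
    have "a * (- 1) < a * e" using e that n by simp
    then have "- 1 < e" using a_pos by (metis mult_less_cancel_left_pos)
    then have "0 \<le> a * e" using a_pos by simp
    then show ?thesis using that e by (simp add: points_def)
  qed
  have f_in: "f j \<in> points n" if j: "0 \<le> j" "j \<le> int p" for j
  proof (cases "j * u \<le> z")
    case True
    have "n - ((y + j * P) * b + (z - j * u) * c) = n - (y * b + z * c) - j * (d * a)"
      unfolding weight_add_w by simp
    then have dv: "a dvd n - ((y + j * P) * b + (z - j * u) * c)"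
      using dvd_diff[OF dvd0, of "j * (d * a)"] by (metis dvd_triv_right dvd_mult)
    have "j * u * c \<le> int p * u * c" using j u_pos c_pos by (intro mult_right_mono) auto
    then have w: "j * (d * a) \<le> int p * u * c" using j_weight_w_le[OF j(1)] by simp
    \<comment> \<open>The rectangle of the L-shape is dominated by the first corner, the block on
      top by the second.\<close>
    have "y * b + z * c + int p * u * c \<le> M"
    proof (cases "z < q")
      case True
      then have "y * b + z * c \<le> (P - 1) * b + (q - 1) * c" using y by (intro mono) auto
      then show ?thesis using A by (simp add: algebra_simps)
    next
      case False
      then have "y * b + z * c \<le> (r - 1) * b + (q + u - 1) * c" using z by (intro mono) auto
      then show ?thesis using B by (simp add: algebra_simps)
    qed
    then have "(y + j * P) * b + (z - j * u) * c \<le> M" using w unfolding weight_add_w by simp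
    then show ?thesis using True j y P_pos dv by (simp add: f_def in_points)
  next
    case False
    define l where "l = int p - j"
    have l: "0 \<le> l" "l \<le> int p" using j by (auto simp: l_def)
    have "n - ((y1 + l * P) * b + (z1 - l * u) * c) = n - (y1 * b + z1 * c) - l * (d * a)"
      unfolding weight_add_w by simp
    then have dv: "a dvd n - ((y1 + l * P) * b + (z1 - l * u) * c)"
      using dvd_diff[OF dvd1, of "l * (d * a)"] by (metis dvd_triv_right dvd_mult)
    have "l * u \<le> int p * u" using l u_pos by (intro mult_right_mono) auto
    \<comment> \<open>Here \<open>int p * u < q\<close> keeps the second chain inside the quadrant
      for up to \<open>p\<close> steps.\<close>
    then have nonneg: "0 \<le> z1 - l * u" using z1 z pu by simp
    have w: "l * (d * a) \<le> int p * u * c - j * u * c"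
      using j_weight_w_le[OF l(1)] by (simp add: l_def algebra_simps)
    \<comment> \<open>Failure of \<open>j * u \<le> z\<close> means
      \<open>z \<le> j * u - 1\<close>; this \<open>j * u\<close> cancels the one subtracted and
      leaves the corner.\<close>
    have "y1 * b + z1 * c + (int p * u * c - j * u * c) \<le> M"
      using corner1
    proof
      assume "z1 = z + q"
      then have "y1 * b + z1 * c \<le> (P - 1) * b + (q + j * u - 1) * c"
        using y1 False by (intro mono) auto
      then show ?thesis using A by (simp add: algebra_simps)
    next
      assume "y1 < r \<and> z1 = z + q + u"
      then have "y1 * b + z1 * c \<le> (r - 1) * b + (q + u + j * u - 1) * c"
        using False by (intro mono) auto
      then show ?thesis using B by (simp add: algebra_simps)
    qed
    then have "(y1 + l * P) * b + (z1 - l * u) * c \<le> M" using w unfolding weight_add_w by simp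
    then show ?thesis using False l y1 P_pos dv nonneg
      by (simp add: f_def in_points l_def[symmetric])
  qed
  \<comment> \<open>\<open>u * y + P * z\<close> is constant along \<open>w\<close> and thus tells the two chains apart.\<close>
  have f_val: "u * fst (f j) + P * snd (f j) = u * y + P * z + (if j * u \<le> z then 0 else a)" for j
    using val1 by (simp add: f_def algebra_simps)
  have "inj_on f {0..int p}"
  proof (rule inj_onI)
    fix i j assume eq: "f i = f j"
    then have "(i * u \<le> z) = (j * u \<le> z)" using f_val[of i] f_val[of j] a_pos by (auto split: if_splits)
    then show "i = j" using eq P_pos by (auto simp: f_def split: if_splits)
  qed
  then have "card {0..int p} \<le> card (points n)"
    using f_in by (intro card_inj_on_le[OF _ _ finite_points]) auto
  then show ?thesis by simp
qed

section \<open>At most \<open>p\<close> representations at the corners\<close>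

text \<open>A point lighter than \<open>(Y, Z)\<close> in the same class must lie at least one
  \<open>v\<close> below it: with \<open>Y < P\<close>, going down along \<open>w\<close> is limited
  by \<open>0 \<le> y\<close>, and the weight of \<open>v\<close> outweighs that of
  \<open>w\<close>.\<close>

lemma lighter_point:
  assumes s: "(y, z) \<in> points (Y * b + Z * c - a)" and Y: "Y < P"
  obtains m n where "1 \<le> m" "y = Y - m * r + n * P" "z = Z - m * q - n * u"
proof -
  have yz: "0 \<le> y" "0 \<le> z" "y * b + z * c \<le> Y * b + Z * c - a"
    and dv: "a dvd Y * b + Z * c - a - (y * b + z * c)"
    using s by (auto simp: points_def)
  have "(y - Y) * b + (z - Z) * c = - (Y * b + Z * c - a - (y * b + z * c)) - a"
    by (simp add: algebra_simps)
  then have "a dvd (y - Y) * b + (z - Z) * c"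
    using dvd_diff[OF _ dvd_refl, of a "- (Y * b + Z * c - a - (y * b + z * c))"] dv
    by (simp only: dvd_minus_iff)
  then obtain m n where m: "y - Y = m * r + n * P" and n: "z - Z = m * q - n * u"
    by (rule lattice_decomposition)
  \<comment> \<open>Here \<open>m\<close> has the opposite sign to the one finally delivered. If it
    were nonnegative, then \<open>n \<ge> - m\<close>, and the weight could not drop.\<close>
  have "m < 0"
  proof (rule ccontr)
    assume "\<not> m < 0"
    then have m0: "0 \<le> m" by simp
    have "m * r \<le> m * P" using m0 r_less by (intro mult_left_mono) auto
    then have "0 < (m + 1 + n) * P" using m yz Y by (simp add: algebra_simps)
    then have nm: "- m \<le> n" using P_pos by (simp add: zero_less_mult_iff)
    have "(- m) * (d * a) \<le> n * (d * a)" using nm d_pos a_pos by (intro mult_right_mono) auto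
    moreover have "m * (d * a) \<le> m * u * c" by (rule j_weight_w_le[OF m0])
    moreover have "m * u * c \<le> m * (q * c)"
      using m0 u_less_q c_pos by (auto simp: mult.assoc intro!: mult_left_mono mult_right_mono)
    moreover have "0 \<le> m * (r * b)" using m0 r_nonneg a_pos a_less_b by simp
    moreover have "(y - Y) * b + (z - Z) * c = m * (r * b) + m * (q * c) + n * (d * a)"
      unfolding m n d_eq[symmetric] by (simp add: algebra_simps)
    ultimately have "0 \<le> (y - Y) * b + (z - Z) * c" by (simp add: algebra_simps)
    then show False using yz a_pos by (simp add: algebra_simps)
  qed
  then show thesis using that[of "- m" n] m n by (simp add: algebra_simps)
qed

text \<open>Nonnegative \<open>y\<close> forces \<open>n \<ge> 0\<close>; nonnegative
  \<open>z\<close> forces \<open>m = 1\<close>, since \<open>2 * q\<close> is too much to subtract,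
  and then \<open>n < p\<close>.\<close>

lemma card_points_corner_A:
  assumes pu: "int p * u < q"
  shows "card (points ((P - 1) * b + (q + int p * u - 1) * c - a)) \<le> p"
    (is "card (points ?N) \<le> p")
proof -
  have "points ?N \<subseteq> (\<lambda>n. (P - 1 - r + n * P, int p * u - 1 - n * u)) ` {0..<int p}"
  proof
    fix s assume s: "s \<in> points ?N"
    obtain y z where yz: "s = (y, z)" by (cases s)
    then have nonneg: "0 \<le> y" "0 \<le> z" using s by (auto simp: points_def)
    obtain m n where m: "1 \<le> m" and y: "y = P - 1 - m * r + n * P"
      and z: "z = q + int p * u - 1 - m * q - n * u"
      using s unfolding yz by (rule lighter_point) auto
    have "0 \<le> m * r" using m r_nonneg by simp
    then have "0 < (n + 1) * P" using y nonneg by (simp add: algebra_simps)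
    then have n: "0 \<le> n" using P_pos by (simp add: zero_less_mult_iff)
    have "m = 1"
    proof (rule ccontr)
      assume "m \<noteq> 1"
      then have "2 * q \<le> m * q" using m u_pos u_less_q by (intro mult_right_mono) auto
      moreover have "0 \<le> n * u" using n u_pos by simp
      ultimately show False using z nonneg pu by simp
    qed
    then have "0 < (int p - n) * u" using z nonneg by (simp add: algebra_simps)
    then have "n < int p" using u_pos by (simp add: zero_less_mult_iff)
    then show "s \<in> (\<lambda>n. (P - 1 - r + n * P, int p * u - 1 - n * u)) ` {0..<int p}"
      using n y z yz \<open>m = 1\<close> by auto
  qed
  then have "card (points ?N) \<le> card {0..<int p}" by (rule surj_card_le[rotated]) simp
  then show ?thesis by simp
qed

text \<open>As for the other corner, but \<open>y\<close> now forces \<open>n \<ge> 1\<close> and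
  \<open>z\<close> allows \<open>n \<le> p\<close>. The case \<open>r = 0\<close>, where the corner
  lies outside the quadrant, is included.\<close>

lemma card_points_corner_B:
  assumes pu: "int p * u < q"
  shows "card (points ((r - 1) * b + (q + (int p + 1) * u - 1) * c - a)) \<le> p"
    (is "card (points ?N) \<le> p")
proof -
  have "points ?N \<subseteq> (\<lambda>n. (n * P - 1, (int p + 1) * u - 1 - n * u)) ` {1..int p}"
  proof
    fix s assume s: "s \<in> points ?N"
    obtain y z where yz: "s = (y, z)" by (cases s)
    then have nonneg: "0 \<le> y" "0 \<le> z" using s by (auto simp: points_def)
    obtain m n where m: "1 \<le> m" and y: "y = r - 1 - m * r + n * P"
      and z: "z = q + (int p + 1) * u - 1 - m * q - n * u"
      using s unfolding yz by (rule lighter_point) (use r_less in auto)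
    have "1 * r \<le> m * r" using m r_nonneg by (intro mult_right_mono) auto
    then have "0 < n * P" using y nonneg by simp
    then have n: "1 \<le> n" using P_pos by (simp add: zero_less_mult_iff)
    have "m = 1"
    proof (rule ccontr)
      assume "m \<noteq> 1"
      then have "2 * q \<le> m * q" using m u_pos u_less_q by (intro mult_right_mono) auto
      moreover have "1 * u \<le> n * u" using n u_pos by (intro mult_right_mono) auto
      ultimately show False using z nonneg pu by (simp add: algebra_simps)
    qed
    then have "0 < (int p + 1 - n) * u" using z nonneg by (simp add: algebra_simps)
    then have "n \<le> int p" using u_pos by (simp add: zero_less_mult_iff)
    then show "s \<in> (\<lambda>n. (n * P - 1, (int p + 1) * u - 1 - n * u)) ` {1..int p}"
      using n y z yz \<open>m = 1\<close> by auto
  qed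
  then have "card (points ?N) \<le> card {1..int p}" by (rule surj_card_le[rotated]) simp
  then show ?thesis by simp
qed

text \<open>The heavier corner minus \<open>a\<close> is the answer; the corners differ by
  \<open>r * b - d * a\<close>, whose sign decides the case.\<close>

theorem frobenius_eq_corner:
  assumes pu: "int p * u < q"
  shows "frobenius p {a, b, c} =
    (if d * a < r * b then (r - 1) * b + (q + (int p + 1) * u - 1) * c - a
     else (P - 1) * b + (q + int p * u - 1) * c - a)"
proof -
  define A where "A = (P - 1) * b + (q + int p * u - 1) * c"
  define B where "B = (r - 1) * b + (q + (int p + 1) * u - 1) * c"
  have diff: "B - A = r * b - d * a"
    unfolding A_def B_def d_eq[symmetric] by (simp add: algebra_simps)
  have "0 \<le> (P - 1) * b" using P_pos a_pos a_less_b by simp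
  moreover have "0 \<le> int p * u" using u_pos by simp
  then have "1 * c \<le> (q + int p * u - 1) * c"
    using u_pos u_less_q c_pos by (intro mult_right_mono) linarith+
  ultimately have A_ge: "a \<le> A" unfolding A_def using a_less_b b_less_c by simp
  have gt: "p < card (representations {a, b, c} n)" if "A \<le> M" "B \<le> M" "M - a < n" for M n
    using that card_points_gt[OF pu] unfolding card_representations A_def B_def by blast
  have cA: "card (representations {a, b, c} (A - a)) \<le> p"
    unfolding card_representations A_def by (rule card_points_corner_A[OF pu])
  have cB: "card (representations {a, b, c} (B - a)) \<le> p"
    unfolding card_representations B_def by (rule card_points_corner_B[OF pu])
  show ?thesis
  proof (cases "d * a < r * b")
    case True
    have "frobenius p {a, b, c} = B - a"
      by (rule frobenius_eqI[OF _ cB gt[of B]]) (use True diff A_ge in auto)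
    then show ?thesis using True by (simp add: B_def)
  next
    case False
    have "frobenius p {a, b, c} = A - a"
      by (rule frobenius_eqI[OF _ cA gt[of A]]) (use False diff A_ge in auto)
    then show ?thesis using False by (simp add: A_def)
  qed
qed

end

section \<open>Pell-type numbers and the quotient \<open>q\<close>\<close>

lemma pell_add: "pell u (Suc (m + n)) = pell u (Suc m) * pell u (Suc n) + pell u m * pell u n"
proof (induction m arbitrary: n)
  case (Suc m)
  show ?case using Suc[of "Suc n"] by (simp add: algebra_simps)
qed simp

lemma coprime_pell_Suc: "coprime (pell u n) (pell u (Suc n))"
proof (induction n)
  case (Suc n)
  have "gcd (pell u (Suc n)) (u * pell u (Suc n) + pell u n) = gcd (pell u (Suc n)) (pell u n)"
    using gcd_add_mult[of "pell u (Suc n)" u "pell u n"] by (simp add: ac_simps)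
  then show ?case using Suc by (simp add: coprime_iff_gcd_eq_1 gcd.commute)
qed simp

lemma pell_nonneg: "0 < u \<Longrightarrow> 0 \<le> pell u n"
  by (induction u n rule: pell.induct) auto

lemma pell_Suc_pos: "0 < u \<Longrightarrow> 0 < pell u (Suc n)"
proof (induction n)
  case (Suc n)
  then show ?case using pell_nonneg[of u n] by (simp add: add_pos_nonneg)
qed simp

lemma pell_pos: "0 < u \<Longrightarrow> 0 < n \<Longrightarrow> 0 < pell u n"
  using pell_Suc_pos by (cases n) auto

lemma pell_le_Suc:
  assumes "0 < u" shows "pell u n \<le> pell u (Suc n)"
proof (cases n)
  case (Suc m)
  have "1 * pell u (Suc m) \<le> u * pell u (Suc m)"
    using assms pell_nonneg by (intro mult_right_mono) auto
  then show ?thesis using Suc pell_nonneg[OF assms, of m] by simp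
qed simp

lemma pell_mono: "0 < u \<Longrightarrow> m \<le> n \<Longrightarrow> pell u m \<le> pell u n"
  using pell_le_Suc by (auto intro: lift_Suc_mono_le)

text \<open>The start at index 2 avoids the equal values at indices 1 and 2 when
  \<open>u = 1\<close>.\<close>

lemma pell_strict_mono:
  assumes "0 < u" "2 \<le> m" "m < n" shows "pell u m < pell u n"
proof -
  obtain l where m: "m = Suc (Suc l)" using assms(2) that[of "m - 2"] by simp
  have "1 * pell u m \<le> u * pell u m"
    using assms pell_nonneg by (intro mult_right_mono) auto
  then have "pell u m < pell u (Suc m)"
    using pell_Suc_pos[OF assms(1), of l] unfolding m by simp
  also have "\<dots> \<le> pell u n" using assms by (intro pell_mono) auto
  finally show ?thesis .
qed

text \<open>Modulo \<open>u\<close> the recursion becomes a shift by two indices.\<close>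

lemma pell_odd_cong: "odd n \<Longrightarrow> [pell u n = 1] (mod u)"
proof (induction u n rule: pell.induct)
  case (3 u n)
  then show ?case by (simp add: cong_def)
qed auto

text \<open>The maximum is attained at an explicit value, so \<open>GREATEST\<close> is meaningful.
  Maximality enters later only as \<open>a < (q + u) * P\<close>, which yields \<open>r < P\<close>
  and \<open>u < q\<close>.\<close>

lemma Greatest_cong_one:
  fixes a P u :: int
  assumes "0 < u" "0 < P"
    and q: "q = (GREATEST m. real_of_int m \<le> real_of_int a / real_of_int P \<and> [m = 1] (mod u))"
  shows "[q = 1] (mod u)" "q * P \<le> a" "a < (q + u) * P"
proof -
  have iff: "real_of_int m \<le> real_of_int a / real_of_int P \<longleftrightarrow> m * P \<le> a" for m
    using assms(2) by (simp add: pos_le_divide_eq flip: of_int_mult)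
  \<comment> \<open>Rounds \<open>a div P\<close> down to the class of 1 modulo
    \<open>u\<close>.\<close>
  define e where "e = (a div P - 1) div u"
  have "a div P - 1 - u < u * e" "u * e \<le> a div P - 1"
    using pos_mod_bound[OF assms(1), of "a div P - 1"] pos_mod_sign[OF assms(1), of "a div P - 1"]
      mult_div_mod_eq[of u "a div P - 1"] unfolding e_def by linarith+
  then have bounds: "1 + u * e \<le> a div P" "a div P < 1 + u * e + u" by auto
  have le: "m * P \<le> a \<longleftrightarrow> m \<le> a div P" for m
    unfolding iff[symmetric] by (simp add: le_floor_iff flip: floor_divide_of_int_eq[where ?'a = real])
  have "q = 1 + u * e"
    unfolding q iff le
  proof (rule Greatest_equality)
    show "1 + u * e \<le> a div P \<and> [1 + u * e = 1] (mod u)" using bounds by (simp add: cong_def)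
    fix m assume m: "m \<le> a div P \<and> [m = 1] (mod u)"
    then obtain f where f: "m - 1 = u * f" by (auto simp: cong_iff_dvd_diff elim: dvdE)
    then have "u * f < u * (e + 1)" using m bounds by (simp add: algebra_simps)
    then have "f \<le> e" using assms(1) by simp
    then have "u * f \<le> u * e" using assms(1) by simp
    then show "m \<le> 1 + u * e" using f by simp
  qed
  then show "[q = 1] (mod u)" "q * P \<le> a" "a < (q + u) * P"
    using bounds le[of q] le[of "q + u"] by (auto simp: cong_def)
qed

section \<open>Specialization to Pell-type numbers\<close>

theorem theorem3:
  fixes u q r :: int and i k p :: nat
  assumes "u > 0"
    and "i \<ge> 1"
    and "odd k" and "3 \<le> k" and "k \<le> 2 * i - 1"
    and "q = (GREATEST m. real_of_int m \<le> real_of_int (pell u (2*i+1)) / real_of_int (pell u k)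
                          \<and> [m = 1] (mod u))"
    and "r = (pell u (2*i+1) - q * pell u k) div u"
    and "real p \<le> real_of_int (q - 1) / real_of_int u"
  shows "frobenius p {pell u (2*i+1), pell u (2*i+3), pell u (2*i+k+1)} =
    (if u * r * pell u (2*i) > (pell u (k-2) - (u^2 + 1) * r) * pell u (2*i+1)
     then (r - 1) * pell u (2*i+3) + (q + (int p + 1) * u - 1) * pell u (2*i+k+1) - pell u (2*i+1)
     else (pell u k - 1) * pell u (2*i+3) + (q + int p * u - 1) * pell u (2*i+k+1) - pell u (2*i+1))"
proof -
  define a where "a = pell u (2*i+1)"
  define b where "b = pell u (2*i+3)"
  define c where "c = pell u (2*i+k+1)"
  define t where "t = pell u (2*i)"
  define P where "P = pell u k"
  define d where "d = pell u (k-2)"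
  have u: "0 < u" by fact
  have P_pos: "0 < P" and d_pos: "0 < d" using pell_pos u assms(4) by (auto simp: P_def d_def)
  note q = Greatest_cong_one[OF u P_pos assms(6)[folded a_def P_def]]
  have P1: "[P = 1] (mod u)" unfolding P_def using assms(3) by (rule pell_odd_cong)
  have "[a = 1] (mod u)" unfolding a_def by (rule pell_odd_cong) simp
  moreover have "[q * P = 1 * 1] (mod u)" using q(1) P1 by (rule cong_mult)
  \<comment> \<open>All of \<open>a\<close>, \<open>q\<close> and \<open>P\<close> are 1 modulo
    \<open>u\<close>, so the division defining \<open>r\<close> is exact.\<close>
  ultimately have "u dvd a - q * P" by (metis cong_iff_dvd_diff cong_sym cong_trans mult_1)
  then have ur: "u * r = a - q * P" unfolding assms(7) a_def P_def by simp
  have "0 \<le> u * r" using ur q(2) by simp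
  then have r0: "0 \<le> r" using u by (simp add: zero_le_mult_iff)
  have "u * r < u * P" using ur q(3) by (simp add: algebra_simps)
  then have rP: "r < P" using u by simp
  have b_eq: "b = u * t + (u\<^sup>2 + 1) * a"
    by (simp add: a_def b_def t_def numeral_3_eq_3 power2_eq_square algebra_simps)
  have c_eq: "c = P * t + pell u (k + 1) * a"
    using pell_add[of u "2*i" k] by (simp add: a_def c_def t_def P_def)
  have cop_u: "coprime u P"
    using P1 cong_imp_coprime[of 1 P u] by (simp add: cong_sym coprime_commute)
  have cop_t: "coprime t a" using coprime_pell_Suc[of u "2*i"] by (simp add: t_def a_def)
  obtain l where k: "k = Suc (Suc l)" using assms(4) that[of "k - 2"] by simp
  \<comment> \<open>The \<open>t\<close> terms cancel; two backward uses of the recursion turn the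
    factor of \<open>a\<close> into \<open>pell u (k-2)\<close>.\<close>
  have d_eq: "P * b - u * c = d * a"
    unfolding b_eq c_eq by (simp add: P_def d_def k power2_eq_square algebra_simps)
  have a_less_b: "a < b" and b_less_c: "b < c"
    unfolding a_def b_def c_def using u assms(2,4) by (auto intro!: pell_strict_mono)
  have a_nonneg: "0 \<le> a" unfolding a_def by (rule pell_nonneg[OF u])
  have "d * a \<le> pell u (k + 1) * a"
    unfolding d_def using u a_nonneg by (intro mult_right_mono pell_mono) auto
  moreover have "0 \<le> P * t" using P_pos pell_nonneg[OF u] by (simp add: t_def)
  ultimately have d_le: "d * a \<le> c" unfolding c_eq by simp
  \<comment> \<open>From \<open>k \<le> 2 * i - 1\<close>, both predecessors of \<open>a\<close> in
    the recursion are at least \<open>P\<close>.\<close>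
  have "u * P + P \<le> a"
  proof -
    obtain j where j: "2 * i = Suc j" using assms(2) by (cases "2 * i") auto
    have "P \<le> pell u j" "P \<le> t"
      unfolding P_def t_def using u assms(5) j by (auto intro!: pell_mono)
    moreover have "a = u * t + pell u j" by (simp add: a_def t_def j)
    ultimately show ?thesis using u by (simp add: add_mono)
  qed
  then have "0 < q * P" using q(3) P_pos by (simp add: algebra_simps)
  then have q_pos: "0 < q" using P_pos by (simp add: zero_less_mult_iff)
  \<comment> \<open>The only candidate from 1 to \<open>u\<close> in the class of 1 is
    \<open>q = 1\<close>, which would give \<open>a < (1 + u) * P\<close>.\<close>
  have "u < q"
  proof (rule ccontr)
    assume "\<not> u < q"
    obtain e where e: "q - 1 = u * e" using q(1) by (auto simp: cong_iff_dvd_diff elim: dvdE)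
    have "u * e < u * 1" using e \<open>\<not> u < q\<close> by simp
    moreover have "0 \<le> u * e" using e q_pos by simp
    ultimately have "e = 0" using u by (simp add: zero_le_mult_iff)
    then have "q = 1" using e by simp
    then show False using q(3) \<open>u * P + P \<le> a\<close> by (simp add: algebra_simps)
  qed
  interpret three_generators a b c t u P q r d "u\<^sup>2 + 1" "pell u (k + 1)"
    using u r0 rP \<open>u < q\<close> ur b_eq c_eq cop_u cop_t d_eq d_pos d_le a_less_b b_less_c
    by unfold_locales auto
  have "real p * real_of_int u \<le> real_of_int (q - 1)"
    using assms(8) u by (simp add: pos_le_divide_eq)
  then have "real_of_int (int p * u) \<le> real_of_int (q - 1)" by simp
  then have "int p * u < q" unfolding of_int_le_iff by simp
  then have "frobenius p {a, b, c} =
    (if d * a < r * b then (r - 1) * b + (q + (int p + 1) * u - 1) * c - a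
     else (P - 1) * b + (q + int p * u - 1) * c - a)"
    by (rule frobenius_eq_corner)
  moreover have "d * a < r * b \<longleftrightarrow> (d - (u\<^sup>2 + 1) * r) * a < u * r * t"
    unfolding b_eq by (simp add: algebra_simps)
  ultimately show ?thesis by (simp only: a_def b_def c_def t_def P_def d_def)
qed

end
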